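(* Let $(\mathcal G_1,e_1)$ and $(\mathcal G_2,e_2)$ be rooted graphs with spectral distributions $\mu$ and $\nu$ respectively, and let $(\mathcal G_1\vdash\mathcal G_2,e)$ be their orthogonal product. Fix $v\in V_1\setminus\{e_1\}$, and let $\varphi(T)=\langle T\delta(e),\delta(e)\rangle$ and $\psi(T)=\langle T\delta((v,e_2)),\delta((v,e_2))\rangle$. Then the adjacency operator of $\mathcal G_1\vdash\mathcal G_2$ can be decomposed as $A(\mathcal G_1\vdash\mathcal G_2)=A^{(1)}+A^{(2)}$, where the pair $(A^{(1)},A^{(2)})$ is orthogonal with respect to $(\varphi,\psi)$. Moreover, the spectral distribution of $(\mathcal G_1\vdash\mathcal G_2,e)$ is $\mu\vdash\nu$.
   Context: A graph is a non-oriented, connected, locally finite simple graph (no loops) with nonempty edge set; a rooted graph $(\mathcal G,e)$ is a graph $\mathcal G=(V,E)$ with a distinguished vertex $e$. Its adjacency operator $A$ acts on finitely supported functions on $V$ by $A\delta(x)=\sum_{x'\sim x}\delta(x')$, where $\delta(x)$ is the indicator of $\{x\}$. A spectral distribution of $(\mathcal G,e)$ is a probability measure $\mu$ on $\mathbb R$ with $\int x^n d\mu=\langle A^n\delta(e),\delta(e)\rangle$ for all $n\ge0$. Orthogonal product: for rooted graphs $(\mathcal G_i,e_i)=(V_i,E_i,e_i)$, $\mathcal G_1\vdash\mathcal G_2$ is the rooted graph with vertex set $(( V_1\setminus\{e_1\})\times V_2)\cup\{(e_1,e_2)\}$, root $e=(e_1,e_2)$, and edges $\{(x,e_2),(x',e_2)\}$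 for $\{x,x'\}\in E_1$, and $\{(x,y),(x,y')\}$ for $x\in V_1\setminus\{e_1\}$, $\{y,y'\}\in E_2$ (i.e. a copy of $\mathcal G_2$ is glued by its root to every vertex of $\mathcal G_1$ except the root). Orthogonality: let $\mathcal A$ be a unital algebra with normalized linear functionals $\varphi,\psi$, and $\mathcal A_1,\mathcal A_2$ non-unital subalgebras. $\mathcal A_2$ is orthogonal to $\mathcal A_1$ w.r.t. $(\varphi,\psi)$ if for all $a_1,a_2\in\mathcal A_1$, $b\in\mathcal A_2$ and all $w_1,w_2$ in the unital algebra generated by $\mathcal A_1\cup\mathcal A_2$: (i) $\varphi(bw_2)=\varphi(w_1b)=0$; (ii) $\varphi(w_1a_1ba_2w_2)=\psi(b)\big(\varphi(w_1a_1a_2w_2)-\varphi(w_1a_1)\varphi(a_2w_2)\big)$. A pair $(a,b)$ is orthogonal w.r.t. $(\varphi,\psi)$ if the (non-unital) algebra generated by $b$ is orthogonal to the (non-unital) algebra generated by $a$. (Operators here act on the space of finitely supported functions.) Transforms: for a probability measure $\rho$ with moments $M_n$, $G_\rho(z)=\sum_n M_nz^{-n-1}$, $F_\rho=1/G_\rho$, $K_\rho(z)=z-F_\rho(z)$ as formal series in $z^{-1}$; $\mu\vdash\nu$ denotes the distribution determined by $K_{\mu\vdash\nu}(z)=K_\mu(F_\nu(z))$; saying the spectral distribution "is" $\mu\vdash\nu$ means its moments are those determined by this identity. *)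

theory Defs
  imports
    "HOL-Probability.Probability"
    "HOL-Computational_Algebra.Formal_Laurent_Series"
    "HOL-Library.Poly_Mapping"
    "HOL-Algebra.Module"
begin

section \<open>Rooted graphs and their orthogonal product\<close>

record 'a rgraph =
  verts :: "'a set"
  edges :: "'a set set"
  rt :: 'a

definition nbrs :: "'a set set \<Rightarrow> 'a \<Rightarrow> 'a set" where
  "nbrs E x = {y. {x, y} \<in> E}"

definition rooted_graph :: "'a rgraph \<Rightarrow> bool" where
  "rooted_graph G \<longleftrightarrow>
     rt G \<in> verts G \<and>
     (\<forall>d\<in>edges G. d \<subseteq> verts G \<and> card d = 2) \<and>
     edges G \<noteq> {} \<and>
     (\<forall>x\<in>verts G. finite (nbrs (edges G) x)) \<and>
     (\<forall>x\<in>verts G. \<forall>y\<in>verts G. (x, y) \<in> {(u, w). {u, w} \<in> edges G}\<^sup>*)"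

definition orth_edges1 :: "'a rgraph \<Rightarrow> 'b rgraph \<Rightarrow> ('a \<times> 'b) set set" where
  "orth_edges1 G H = {{(x, rt H), (x', rt H)} | x x'. {x, x'} \<in> edges G}"

definition orth_edges2 :: "'a rgraph \<Rightarrow> 'b rgraph \<Rightarrow> ('a \<times> 'b) set set" where
  "orth_edges2 G H =
     {{(x, y), (x, y')} | x y y'. x \<in> verts G - {rt G} \<and> {y, y'} \<in> edges H}"

definition orth_prod :: "'a rgraph \<Rightarrow> 'b rgraph \<Rightarrow> ('a \<times> 'b) rgraph" where
  "orth_prod G H =
     \<lparr> verts = (verts G - {rt G}) \<times> verts H \<union> {(rt G, rt H)},
       edges = orth_edges1 G H \<union> orth_edges2 G H,
       rt = (rt G, rt H) \<rparr>"

lemma rooted_graph_orth_prod: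
  assumes "rooted_graph G" "rooted_graph H" 
  shows "rooted_graph (orth_prod G H)"
proof -
  let ?P = "orth_prod G H" and ?R = "{(u, w). {u, w} \<in> edges (orth_prod G H)}"
  note a = assms[unfolded rooted_graph_def]
  have symR: "sym ?R" by (auto simp: sym_def insert_commute)
  have g: "rt G \<in> verts G" "rt H \<in> verts H" using a by auto
  have eG: "x \<in> verts G \<and> y \<in> verts G \<and> x \<noteq> y" if "{x,y} \<in> edges G" for x y
    using a that by (cases "x = y") fastforce+
  have eH: "x \<in> verts H \<and> y \<in> verts H \<and> x \<noteq> y" if "{x,y} \<in> edges H" for x y
    using a that by (cases "x = y") fastforce+
  have cH: "((x, rt H), (x, y)) \<in> ?R\<^sup>*" if "x \<in> verts G - {rt G}" "y \<in> verts H" for x y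
  proof -
    have "(rt H, y) \<in> {(u, w). {u, w} \<in> edges H}\<^sup>*" using a that by auto
    then show ?thesis
    proof induction
      case (step y z)
      then have "((x,y),(x,z)) \<in> ?R" using that by (auto simp: orth_prod_def orth_edges2_def)
      from step.IH this show ?case by (rule rtrancl_into_rtrancl)
    qed auto
  qed
  have cG: "((rt G, rt H), (x, rt H)) \<in> ?R\<^sup>*" if "x \<in> verts G" for x
  proof -
    have "(rt G, x) \<in> {(u, w). {u, w} \<in> edges G}\<^sup>*" using a that by auto
    then show ?thesis
    proof induction
      case (step y z)
      then have "((y,rt H),(z,rt H)) \<in> ?R" by (auto simp: orth_prod_def orth_edges1_def)
      from step.IH this show ?case by (rule rtrancl_into_rtrancl)
    qed auto
  qed
  have c: "((rt G, rt H), p) \<in> ?R\<^sup>*" if "p \<in> verts ?P" for p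
    using that cG cH by (auto simp: orth_prod_def intro: rtrancl_trans)
  have sub: "d \<subseteq> verts ?P \<and> card d = 2" if "d \<in> edges ?P" for d
    using that g
    by (auto simp: orth_prod_def orth_edges1_def orth_edges2_def dest!: eG eH)
  have fin: "finite (nbrs (edges ?P) p)" if p: "p \<in> verts ?P" for p
  proof (rule finite_subset)
    show "nbrs (edges ?P) p \<subseteq> nbrs (edges G) (fst p) \<times> {rt H} \<union> {fst p} \<times> nbrs (edges H) (snd p)"
      by (auto simp: nbrs_def orth_prod_def orth_edges1_def orth_edges2_def doubleton_eq_iff insert_commute)
    show "finite (nbrs (edges G) (fst p) \<times> {rt H} \<union> {fst p} \<times> nbrs (edges H) (snd p))"
      using a p g by (auto simp: orth_prod_def)
  qed
  obtain d where "d \<in> edges G" using a by auto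
  then have "card d = 2" "d \<in> edges G" using a by auto
  then obtain x y where "{x,y} \<in> edges G" by (auto simp: card_2_iff)
  then have ne: "edges ?P \<noteq> {}" by (auto simp: orth_prod_def orth_edges1_def)
  have "(p, q) \<in> ?R\<^sup>*" if "p \<in> verts ?P" "q \<in> verts ?P" for p q
    using c[OF that(1)] c[OF that(2)] sym_rtrancl[OF symR] by (meson rtrancl_trans symD)
  moreover have "rt ?P \<in> verts ?P" by (simp add: orth_prod_def)
  ultimately show ?thesis using sub fin ne unfolding rooted_graph_def by blast
qed

section \<open>The algebra of linear operators on finitely supported functions\<close>

definition fin_supp :: "'x set \<Rightarrow> ('x \<Rightarrow>\<^sub>0 complex) set" where
  "fin_supp V = {f. Poly_Mapping.keys f \<subseteq> V}"

definition scale_fn :: "complex \<Rightarrow> ('x \<Rightarrow>\<^sub>0 complex) \<Rightarrow> ('x \<Rightarrow>\<^sub>0 complex)" where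
  "scale_fn c f = Poly_Mapping.map ((*) c) f"

definition delta :: "'x \<Rightarrow> ('x \<Rightarrow>\<^sub>0 complex)" where
  "delta x = Poly_Mapping.single x 1"

definition fs_inner :: "('x \<Rightarrow>\<^sub>0 complex) \<Rightarrow> ('x \<Rightarrow>\<^sub>0 complex) \<Rightarrow> complex" where
  "fs_inner f g =
     (\<Sum>x\<in>Poly_Mapping.keys f. Poly_Mapping.lookup f x * cnj (Poly_Mapping.lookup g x))"

type_synonym 'x fs_op = "('x \<Rightarrow>\<^sub>0 complex) \<Rightarrow> ('x \<Rightarrow>\<^sub>0 complex)"

text \<open>As a function on the whole type, an operator on \<^term>\<open>fin_supp V\<close> is taken to be
  extensional, so that equality in the carrier is equality of operators on \<^term>\<open>fin_supp V\<close>.\<close>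

definition op_alg :: "'x set \<Rightarrow> (complex, 'x fs_op) module" where
  "op_alg V =
     \<lparr> carrier = {T \<in> fin_supp V \<rightarrow>\<^sub>E fin_supp V.
         (\<forall>f\<in>fin_supp V. \<forall>g\<in>fin_supp V. T (f + g) = T f + T g) \<and>
         (\<forall>c. \<forall>f\<in>fin_supp V. T (scale_fn c f) = scale_fn c (T f))},
       mult = compose (fin_supp V),
       one = (\<lambda>f\<in>fin_supp V. f),
       zero = (\<lambda>f\<in>fin_supp V. 0),
       add = (\<lambda>S T. \<lambda>f\<in>fin_supp V. S f + T f),
       smult = (\<lambda>c T. \<lambda>f\<in>fin_supp V. scale_fn c (T f)) \<rparr>"

definition vec_state :: "'x \<Rightarrow> 'x fs_op \<Rightarrow> complex" where
  "vec_state x T = fs_inner (T (delta x)) (delta x)"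

lemma lookup_scale_fn [simp]:
  "Poly_Mapping.lookup (scale_fn c f) x = c * Poly_Mapping.lookup f x"
  by (simp add: scale_fn_def Poly_Mapping.map.rep_eq when_def)

lemma fin_supp_iff: "f \<in> fin_supp V \<longleftrightarrow> (\<forall>x. x \<notin> V \<longrightarrow> Poly_Mapping.lookup f x = 0)"
  by (auto simp: fin_supp_def in_keys_iff subset_iff)

lemma fin_supp_closed [simp]:
  "0 \<in> fin_supp V"
  "f \<in> fin_supp V \<Longrightarrow> g \<in> fin_supp V \<Longrightarrow> f + g \<in> fin_supp V"
  "f \<in> fin_supp V \<Longrightarrow> - f \<in> fin_supp V"
  "f \<in> fin_supp V \<Longrightarrow> scale_fn c f \<in> fin_supp V"
  by (auto simp: fin_supp_iff lookup_add)

lemma scale_fn_simps [simp]: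
  "scale_fn c 0 = 0"
  "scale_fn c (f + g) = scale_fn c f + scale_fn c g"
  "scale_fn c (- f) = - scale_fn c f"
  by (auto intro!: poly_mapping_eqI simp: lookup_add algebra_simps)

lemma ring_op_alg: "ring (op_alg V)"
proof (rule ringI)
  show "abelian_group (op_alg V)"
  proof (rule abelian_groupI)
    fix S assume S: "S \<in> carrier (op_alg V)"
    then show "\<exists>T\<in>carrier (op_alg V). T \<oplus>\<^bsub>op_alg V\<^esub> S = \<zero>\<^bsub>op_alg V\<^esub>"
      by (intro bexI[of _ "\<lambda>f\<in>fin_supp V. - S f"])
         (auto simp: op_alg_def PiE_iff intro!: restrict_ext)
  qed (auto simp: op_alg_def PiE_iff add_ac intro!: restrict_ext extensionalityI[of _ "fin_supp V"])
  show "monoid (op_alg V)"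
    by (rule monoidI) (auto simp: op_alg_def PiE_iff compose_def intro!: extensionalityI[of _ "fin_supp V"])
qed (auto simp: op_alg_def PiE_iff compose_def intro!: restrict_ext)

lemma vec_state_one: "x \<in> V \<Longrightarrow> vec_state x \<one>\<^bsub>op_alg V\<^esub> = 1"
  by (auto simp: vec_state_def op_alg_def fs_inner_def delta_def fin_supp_def)

lemma vec_state_eq: "vec_state x T = Poly_Mapping.lookup (T (delta x)) x"
proof -
  have "vec_state x T =
      (\<Sum>y\<in>Poly_Mapping.keys (T (delta x)). if y = x then Poly_Mapping.lookup (T (delta x)) y else 0)"
    unfolding vec_state_def fs_inner_def
    by (intro sum.cong) (auto simp: delta_def lookup_single when_def)
  then show ?thesis by (simp add: in_keys_iff)
qed

lemma vec_state_linear: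
  assumes "x \<in> V"
  shows "vec_state x (S \<oplus>\<^bsub>op_alg V\<^esub> T) = vec_state x S + vec_state x T"
    and "vec_state x (c \<odot>\<^bsub>op_alg V\<^esub> T) = c * vec_state x T"
  using assms by (auto simp: vec_state_eq op_alg_def lookup_add delta_def fin_supp_def)

text \<open>The linear extension of \<open>\<delta>(x) \<mapsto> \<Sum>x' \<sim> x. \<delta>(x')\<close>, adjacency being given by \<open>E\<close>.\<close>

definition adj_op :: "'x set \<Rightarrow> 'x set set \<Rightarrow> 'x fs_op" where
  "adj_op V E = (\<lambda>f\<in>fin_supp V.
     \<Sum>x\<in>Poly_Mapping.keys f. scale_fn (Poly_Mapping.lookup f x) (\<Sum>x'\<in>nbrs E x. delta x'))"

definition adjacency :: "'a rgraph \<Rightarrow> 'a fs_op" where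
  "adjacency G = adj_op (verts G) (edges G)"

section \<open>Orthogonality\<close>

inductive_set gen_alg :: "('c, 'a, 'm) module_scheme \<Rightarrow> 'a set \<Rightarrow> 'a set"
  for M :: "('c, 'a, 'm) module_scheme" (structure) and S :: "'a set" where
  zero: "\<zero> \<in> gen_alg M S"
| incl: "a \<in> S \<Longrightarrow> a \<in> gen_alg M S"
| add: "a \<in> gen_alg M S \<Longrightarrow> b \<in> gen_alg M S \<Longrightarrow> a \<oplus> b \<in> gen_alg M S"
| smult: "a \<in> gen_alg M S \<Longrightarrow> c \<odot> a \<in> gen_alg M S"
| mult: "a \<in> gen_alg M S \<Longrightarrow> b \<in> gen_alg M S \<Longrightarrow> a \<otimes> b \<in> gen_alg M S"

definition gen_unital_alg :: "('c, 'a, 'm) module_scheme \<Rightarrow> 'a set \<Rightarrow> 'a set" where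
  "gen_unital_alg M S = gen_alg M (insert \<one>\<^bsub>M\<^esub> S)"

text \<open>\<open>A2\<close> is orthogonal to \<open>A1\<close> with respect to \<open>(\<phi>, \<psi>)\<close>.\<close>

definition orthogonal_subalg ::
  "('c, 'a, 'm) module_scheme \<Rightarrow> ('a \<Rightarrow> complex) \<Rightarrow> ('a \<Rightarrow> complex) \<Rightarrow> 'a set \<Rightarrow> 'a set \<Rightarrow> bool"
  where
  "orthogonal_subalg M \<phi> \<psi> A1 A2 \<longleftrightarrow>
     (\<forall>a1\<in>A1. \<forall>a2\<in>A1. \<forall>b\<in>A2.
      \<forall>w1\<in>gen_unital_alg M (A1 \<union> A2). \<forall>w2\<in>gen_unital_alg M (A1 \<union> A2).
        \<phi> (b \<otimes>\<^bsub>M\<^esub> w2) = 0 \<and> \<phi> (w1 \<otimes>\<^bsub>M\<^esub> b) = 0 \<and>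
        \<phi> (w1 \<otimes>\<^bsub>M\<^esub> a1 \<otimes>\<^bsub>M\<^esub> b \<otimes>\<^bsub>M\<^esub> a2 \<otimes>\<^bsub>M\<^esub> w2) =
          \<psi> b * (\<phi> (w1 \<otimes>\<^bsub>M\<^esub> a1 \<otimes>\<^bsub>M\<^esub> a2 \<otimes>\<^bsub>M\<^esub> w2)
                  - \<phi> (w1 \<otimes>\<^bsub>M\<^esub> a1) * \<phi> (a2 \<otimes>\<^bsub>M\<^esub> w2)))"

definition orthogonal_pair ::
  "('c, 'a, 'm) module_scheme \<Rightarrow> ('a \<Rightarrow> complex) \<Rightarrow> ('a \<Rightarrow> complex) \<Rightarrow> 'a \<Rightarrow> 'a \<Rightarrow> bool"
  where
  "orthogonal_pair M \<phi> \<psi> a b \<longleftrightarrow> orthogonal_subalg M \<phi> \<psi> (gen_alg M {a}) (gen_alg M {b})"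

section \<open>Spectral distributions\<close>

definition root_moment :: "'a rgraph \<Rightarrow> nat \<Rightarrow> complex" where
  "root_moment G n = vec_state (rt G) (adjacency G [^]\<^bsub>op_alg (verts G)\<^esub> n)"

definition spectral_distribution :: "'a rgraph \<Rightarrow> real measure \<Rightarrow> bool" where
  "spectral_distribution G \<mu> \<longleftrightarrow> real_distribution \<mu> \<and>
     (\<forall>n. integrable \<mu> (\<lambda>x. x ^ n) \<and> complex_of_real (\<integral>x. x ^ n \<partial>\<mu>) = root_moment G n)"

definition moment :: "real measure \<Rightarrow> nat \<Rightarrow> complex" where
  "moment \<rho> n = complex_of_real (\<integral>x. x ^ n \<partial>\<rho>)"

section \<open>Transforms and the orthogonal convolution\<close>

text \<open>The transforms depend on a measure only through its moments, so they are defined for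
  moment sequences. The indeterminate of the Laurent series stands for \<open>1/z\<close>; thus the
  variable \<open>z\<close> itself is \<^term>\<open>fls_X_inv\<close>.\<close>

definition G_transform :: "(nat \<Rightarrow> complex) \<Rightarrow> complex fls" where
  "G_transform m = fps_to_fls (fps_X * Abs_fps m)"

definition F_transform :: "(nat \<Rightarrow> complex) \<Rightarrow> complex fls" where
  "F_transform m = inverse (G_transform m)"

definition K_transform :: "(nat \<Rightarrow> complex) \<Rightarrow> complex fls" where
  "K_transform m = fls_X_inv - F_transform m"

text \<open>\<open>f(F(z))\<close>: as the indeterminate is \<open>1/z\<close>, replacing \<open>z\<close> by \<open>F(z)\<close> replaces the
  indeterminate by \<open>1/F\<close>, which is a power series without constant term for
  \<open>F = F_transform m\<close>.\<close>

definition subst_z :: "complex fls \<Rightarrow> complex fls \<Rightarrow> complex fls" where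
  "subst_z f F = fls_compose_fps f (fls_regpart (inverse F))"

definition orth_conv_moments ::
  "(nat \<Rightarrow> complex) \<Rightarrow> (nat \<Rightarrow> complex) \<Rightarrow> (nat \<Rightarrow> complex) \<Rightarrow> bool" where
  "orth_conv_moments m m\<^sub>1 m\<^sub>2 \<longleftrightarrow>
     K_transform m = subst_z (K_transform m\<^sub>1) (F_transform m\<^sub>2)"

end

theory Submission
  imports Defs
begin

text \<open>Operators from the algebra generated by \<open>A\<^sup>(\<^sup>1\<^sup>)\<close> only see, and only produce, values on the
  copy \<open>V\<^sub>1 \<times> {e\<^sub>2}\<close> of \<open>V\<^sub>1\<close>; those from the algebra generated by \<open>A\<^sup>(\<^sup>2\<^sup>)\<close> annihilate the root
  and act in the same way on every fibre \<open>{x} \<times> V\<^sub>2\<close> with \<open>x \<noteq> e\<^sub>1\<close>. Hence, compressed to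
  \<open>V\<^sub>1 \<times> {e\<^sub>2}\<close>, such a \<open>b\<close> is \<open>\<psi>(b)\<close> times the projection onto the complement of the root,
  which is orthogonality.

  For the moments, let \<open>u(x) = \<Sum>n. (A^n \<delta>(e))(x) X^n\<close>, which is the only family of power
  series with \<open>u(x) = [x = e] + X \<Sum>x' \<sim> x. u(x')\<close>. If \<open>g\<close> and \<open>h\<close> are the families of the two
  factors and \<open>H = X h(e\<^sub>2)\<close>, then \<open>(x, y) \<mapsto> c (g(x) \<circ> H) h(y)\<close> solves the system of the
  orthogonal product for a suitable scalar series \<open>c\<close>, and its value at the root gives the
  identity of the \<open>K\<close>-transforms.\<close>

section \<open>Adjacency operators\<close>

text \<open>Stated for a bare edge set because \<open>orth_edges1\<close> and
  \<open>orth_edges2\<close> are handled separately, and neither need give a connected graph on the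
  vertices of the product.\<close>

definition locally_finite :: "'x set \<Rightarrow> 'x set set \<Rightarrow> bool" where
  "locally_finite V E \<longleftrightarrow> (\<forall>x\<in>V. finite (nbrs E x) \<and> nbrs E x \<subseteq> V)"

lemma locally_finiteD:
  assumes "locally_finite V E" "x \<in> V"
  shows "finite (nbrs E x)" and "y \<in> nbrs E x \<Longrightarrow> y \<in> V"
  using assms by (auto simp: locally_finite_def)

lemma nbrs_sym: "y \<in> nbrs E x \<longleftrightarrow> x \<in> nbrs E y"
  by (simp add: nbrs_def insert_commute)

lemma lookup_sum_delta:
  assumes "finite A"
  shows "Poly_Mapping.lookup (\<Sum>x'\<in>A. delta x') x = (if x \<in> A then 1 else 0)"
  using assms by (simp add: lookup_sum delta_def lookup_single when_def)

lemma lookup_delta: "Poly_Mapping.lookup (delta x) y = (if x = y then 1 else 0)"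
  by (simp add: delta_def lookup_single when_def)

lemma fin_supp_diff [simp]: "f \<in> fin_supp V \<Longrightarrow> g \<in> fin_supp V \<Longrightarrow> f - g \<in> fin_supp V"
  by (simp add: fin_supp_iff lookup_minus)

lemma delta_in_fin_supp [simp]: "delta x \<in> fin_supp V \<longleftrightarrow> x \<in> V"
  by (auto simp: fin_supp_iff lookup_delta)

text \<open>The definition of \<open>adj_op\<close> pushes each value out to the neighbours. As
  adjacency is symmetric (\<open>nbrs_sym\<close>), a value of the result can instead be collected
  from the neighbours, and the sum no longer involves the support of \<open>f\<close>.\<close>

lemma lookup_adj_op:
  assumes "locally_finite V E" "f \<in> fin_supp V" "x \<in> V"
  shows "Poly_Mapping.lookup (adj_op V E f) x = (\<Sum>z\<in>nbrs E x. Poly_Mapping.lookup f z)"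
proof -
  have K: "Poly_Mapping.keys f \<subseteq> V" using assms by (simp add: fin_supp_def)
  have "Poly_Mapping.lookup (adj_op V E f) x =
      (\<Sum>z\<in>Poly_Mapping.keys f. Poly_Mapping.lookup f z *
          Poly_Mapping.lookup (\<Sum>x'\<in>nbrs E z. delta x') x)"
    using assms by (simp add: adj_op_def lookup_sum)
  also have "\<dots> = (\<Sum>z\<in>Poly_Mapping.keys f. if z \<in> nbrs E x then Poly_Mapping.lookup f z else 0)"
    using K assms(1) by (intro sum.cong) (auto simp: lookup_sum_delta locally_finite_def nbrs_sym)
  also have "\<dots> = (\<Sum>z\<in>Poly_Mapping.keys f \<inter> nbrs E x. Poly_Mapping.lookup f z)"
    by (simp add: sum.inter_restrict)
  also have "\<dots> = (\<Sum>z\<in>nbrs E x. Poly_Mapping.lookup f z)"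
    using assms by (intro sum.mono_neutral_left) (auto simp: locally_finite_def in_keys_iff)
  finally show ?thesis .
qed

lemma lookup_adj_op_outside:
  assumes "locally_finite V E" "f \<in> fin_supp V" "x \<notin> V"
  shows "Poly_Mapping.lookup (adj_op V E f) x = 0"
proof -
  have "Poly_Mapping.lookup (\<Sum>x'\<in>nbrs E z. delta x') x = 0" if "z \<in> Poly_Mapping.keys f" for z
  proof -
    have "z \<in> V" using assms(2) that by (auto simp: fin_supp_def)
    then show ?thesis
      using assms(1,3) by (subst lookup_sum_delta) (auto simp: locally_finite_def)
  qed
  then show ?thesis
    using assms by (simp add: adj_op_def lookup_sum)
qed

lemma adj_op_carrier:
  assumes "locally_finite V E"
  shows "adj_op V E \<in> carrier (op_alg V)"
proof -
  have cl: "adj_op V E f \<in> fin_supp V" if "f \<in> fin_supp V" for f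
    using lookup_adj_op_outside[OF assms that] by (simp add: fin_supp_iff)
  have add: "adj_op V E (f + g) = adj_op V E f + adj_op V E g"
    if "f \<in> fin_supp V" "g \<in> fin_supp V" for f g
  proof (rule poly_mapping_eqI)
    fix x
    show "Poly_Mapping.lookup (adj_op V E (f + g)) x =
        Poly_Mapping.lookup (adj_op V E f + adj_op V E g) x"
      using that assms
      by (cases "x \<in> V")
         (simp_all add: lookup_add lookup_adj_op lookup_adj_op_outside sum.distrib)
  qed
  have scale: "adj_op V E (scale_fn c f) = scale_fn c (adj_op V E f)"
    if "f \<in> fin_supp V" for c f
  proof (rule poly_mapping_eqI)
    fix x
    show "Poly_Mapping.lookup (adj_op V E (scale_fn c f)) x =
        Poly_Mapping.lookup (scale_fn c (adj_op V E f)) x"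
      using that assms
      by (cases "x \<in> V") (simp_all add: lookup_adj_op lookup_adj_op_outside sum_distrib_left)
  qed
  have "adj_op V E \<in> extensional (fin_supp V)"
    by (simp add: adj_op_def)
  then show ?thesis
    using cl add scale by (simp add: op_alg_def PiE_iff)
qed

text \<open>Disjoint neighbourhoods ensure that no neighbour is counted by both summands.\<close>

lemma adj_op_union:
  assumes "locally_finite V E" "locally_finite V E'"
    and "\<And>x. x \<in> V \<Longrightarrow> nbrs E x \<inter> nbrs E' x = {}"
  shows "adj_op V (E \<union> E') = adj_op V E \<oplus>\<^bsub>op_alg V\<^esub> adj_op V E'"
proof -
  have nb: "nbrs (E \<union> E') x = nbrs E x \<union> nbrs E' x" for x
    by (auto simp: nbrs_def)
  have lf: "locally_finite V (E \<union> E')"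
    using assms by (auto simp: locally_finite_def nb)
  have "adj_op V (E \<union> E') f = adj_op V E f + adj_op V E' f" if "f \<in> fin_supp V" for f
  proof (rule poly_mapping_eqI)
    fix x
    show "Poly_Mapping.lookup (adj_op V (E \<union> E') f) x =
        Poly_Mapping.lookup (adj_op V E f + adj_op V E' f) x"
    proof (cases "x \<in> V")
      case True
      then have "finite (nbrs E x)" "finite (nbrs E' x)"
        using assms by (auto simp: locally_finite_def)
      then show ?thesis
        using True that lf assms
        by (simp add: lookup_add lookup_adj_op nb sum.union_disjoint)
    qed (use that lf assms in \<open>simp add: lookup_add lookup_adj_op_outside\<close>)
  qed
  then have "adj_op V (E \<union> E') = (\<lambda>f\<in>fin_supp V. adj_op V E f + adj_op V E' f)"
    by (intro extensionalityI[of _ "fin_supp V"]) (auto simp: adj_op_def)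
  then show ?thesis
    by (simp add: op_alg_def)
qed

section \<open>The algebra of operators\<close>

lemma op_alg_carrierD:
  assumes "T \<in> carrier (op_alg V)"
  shows "f \<in> fin_supp V \<Longrightarrow> T f \<in> fin_supp V"
    and "f \<in> fin_supp V \<Longrightarrow> g \<in> fin_supp V \<Longrightarrow> T (f + g) = T f + T g"
    and "f \<in> fin_supp V \<Longrightarrow> T (scale_fn c f) = scale_fn c (T f)"
  using assms by (auto simp: op_alg_def)

lemma op_alg_apply:
  assumes "f \<in> fin_supp V"
  shows "\<zero>\<^bsub>op_alg V\<^esub> f = 0" "\<one>\<^bsub>op_alg V\<^esub> f = f" "(S \<otimes>\<^bsub>op_alg V\<^esub> T) f = S (T f)"
    "(S \<oplus>\<^bsub>op_alg V\<^esub> T) f = S f + T f" "(c \<odot>\<^bsub>op_alg V\<^esub> T) f = scale_fn c (T f)"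
  using assms by (simp_all add: op_alg_def compose_eq)

lemma scale_fn_scale_fn: "scale_fn c (scale_fn d f) = scale_fn (c * d) f"
  by (rule poly_mapping_eqI) simp

lemma smult_op_alg_closed:
  assumes "T \<in> carrier (op_alg V)"
  shows "c \<odot>\<^bsub>op_alg V\<^esub> T \<in> carrier (op_alg V)"
  using assms by (auto simp: op_alg_def scale_fn_scale_fn mult.commute dest: PiE_mem)

lemma gen_alg_subset_carrier:
  assumes "S \<subseteq> carrier (op_alg V)"
  shows "gen_alg (op_alg V) S \<subseteq> carrier (op_alg V)"
proof
  interpret ring "op_alg V" by (rule ring_op_alg)
  fix a assume "a \<in> gen_alg (op_alg V) S"
  then show "a \<in> carrier (op_alg V)"
    by induction (use assms smult_op_alg_closed in auto)
qed

lemma gen_unital_alg_subset_carrier: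
  assumes "S \<subseteq> carrier (op_alg V)"
  shows "gen_unital_alg (op_alg V) S \<subseteq> carrier (op_alg V)"
proof -
  interpret ring "op_alg V" by (rule ring_op_alg)
  show ?thesis
    unfolding gen_unital_alg_def using assms by (intro gen_alg_subset_carrier) auto
qed

lemma op_alg_zero_app:
  assumes "T \<in> carrier (op_alg V)"
  shows "T 0 = 0"
  using op_alg_carrierD(2)[OF assms, of 0 0] by simp

lemma op_alg_agree:
  assumes "T \<in> carrier (op_alg V)" "f \<in> fin_supp V" "g \<in> fin_supp V" "T (f - g) = 0"
  shows "T f = T g"
proof -
  have "T f = T ((f - g) + g)" by simp
  also have "\<dots> = T (f - g) + T g"
    using assms by (intro op_alg_carrierD(2)[OF assms(1)]) auto
  finally show ?thesis using assms by simp
qed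

section \<open>Generating series of walks\<close>

text \<open>Uniqueness for the walk system: its constant coefficients are those of
  \<open>delta e\<close>, and comparing coefficients of degree \<open>Suc n\<close> amounts to one
  application of the adjacency operator. Equations at vertices of \<open>V\<close> suffice because
  neighbours stay in \<open>V\<close>.\<close>

lemma coeff_walk_system:
  fixes u :: "'x \<Rightarrow> complex fps"
  assumes lf: "locally_finite V E" and e: "e \<in> V"
    and u: "\<And>x. x \<in> V \<Longrightarrow> u x = (if x = e then 1 else 0) + fps_X * (\<Sum>z\<in>nbrs E x. u z)"
    and x: "x \<in> V"
  shows "fps_nth (u x) n = Poly_Mapping.lookup ((adj_op V E [^]\<^bsub>op_alg V\<^esub> n) (delta e)) x"
  using x
proof (induction n arbitrary: x)
  interpret ring "op_alg V" by (rule ring_op_alg)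
  case 0
  then show ?case
    using e by (subst u) (auto simp: op_alg_apply lookup_delta)
next
  interpret ring "op_alg V" by (rule ring_op_alg)
  case (Suc n)
  have A: "adj_op V E \<in> carrier (op_alg V)" by (rule adj_op_carrier[OF lf])
  have P: "(adj_op V E [^]\<^bsub>op_alg V\<^esub> n) (delta e) \<in> fin_supp V"
    using e by (intro op_alg_carrierD(1)[OF nat_pow_closed[OF A]]) simp
  \<comment> \<open>The power is defined with the new factor on the right. Moving it to the left
    makes it act last, so that \<open>lookup_adj_op\<close> applies to the vector
    \<open>P\<close>.\<close>
  have "adj_op V E [^]\<^bsub>op_alg V\<^esub> Suc n = adj_op V E \<otimes>\<^bsub>op_alg V\<^esub> adj_op V E [^]\<^bsub>op_alg V\<^esub> n"
    by (rule nat_pow_Suc2[OF A])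
  then have "Poly_Mapping.lookup ((adj_op V E [^]\<^bsub>op_alg V\<^esub> Suc n) (delta e)) x =
      (\<Sum>z\<in>nbrs E x. Poly_Mapping.lookup ((adj_op V E [^]\<^bsub>op_alg V\<^esub> n) (delta e)) z)"
    using e lookup_adj_op[OF lf P Suc.prems] by (simp add: op_alg_apply)
  also have "\<dots> = (\<Sum>z\<in>nbrs E x. fps_nth (u z) n)"
    using locally_finiteD[OF lf Suc.prems] by (intro sum.cong refl Suc.IH[symmetric])
  also have "\<dots> = fps_nth (u x) (Suc n)"
    by (subst u[OF Suc.prems]) (simp add: fps_sum_nth)
  finally show ?case by simp
qed

text \<open>The solution is the generating series of the walks from \<open>e\<close> to
  \<open>x\<close>, counted by length. It supplies the families of the two factors from which the
  one of the product is built.\<close>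

lemma walk_system_exists:
  assumes lf: "locally_finite V E" and e: "e \<in> V"
  obtains u :: "'x \<Rightarrow> complex fps" where
    "\<And>x. x \<in> V \<Longrightarrow> u x = (if x = e then 1 else 0) + fps_X * (\<Sum>z\<in>nbrs E x. u z)"
proof -
  interpret ring "op_alg V" by (rule ring_op_alg)
  have A: "adj_op V E \<in> carrier (op_alg V)" by (rule adj_op_carrier[OF lf])
  define u where "u x =
      Abs_fps (\<lambda>n. Poly_Mapping.lookup ((adj_op V E [^]\<^bsub>op_alg V\<^esub> n) (delta e)) x)" for x
  have "u x = (if x = e then 1 else 0) + fps_X * (\<Sum>z\<in>nbrs E x. u z)" if "x \<in> V" for x
  proof (rule fps_ext)
    fix n
    show "fps_nth (u x) n =
        fps_nth ((if x = e then 1 else 0) + fps_X * (\<Sum>z\<in>nbrs E x. u z)) n"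
    proof (cases n)
      case 0
      then show ?thesis using e by (auto simp: u_def op_alg_apply lookup_delta)
    next
      case (Suc k)
      have P: "(adj_op V E [^]\<^bsub>op_alg V\<^esub> k) (delta e) \<in> fin_supp V"
        using e by (intro op_alg_carrierD(1)[OF nat_pow_closed[OF A]]) simp
      have "adj_op V E [^]\<^bsub>op_alg V\<^esub> n = adj_op V E \<otimes>\<^bsub>op_alg V\<^esub> adj_op V E [^]\<^bsub>op_alg V\<^esub> k"
        unfolding Suc by (rule nat_pow_Suc2[OF A])
      then show ?thesis
        using e lookup_adj_op[OF lf P that] Suc by (simp add: u_def op_alg_apply fps_sum_nth)
    qed
  qed
  then show thesis by (rule that)
qed

lemma rooted_graph_locally_finite:
  assumes "rooted_graph G"
  shows "locally_finite (verts G) (edges G)"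
  using assms unfolding rooted_graph_def locally_finite_def nbrs_def by blast

lemma rooted_graph_irrefl:
  assumes "rooted_graph G"
  shows "x \<notin> nbrs (edges G) x"
  using assms by (fastforce simp: rooted_graph_def nbrs_def)

text \<open>By uniqueness, the moments can be read off any solution, in particular off one found by
  an ansatz.\<close>

lemma root_moment_walk_system:
  assumes G: "rooted_graph G"
    and "\<And>x. x \<in> verts G \<Longrightarrow>
      u x = (if x = rt G then 1 else 0) + fps_X * (\<Sum>z\<in>nbrs (edges G) x. u z)"
  shows "Abs_fps (root_moment G) = u (rt G)"
proof (rule fps_ext)
  fix n
  have "rt G \<in> verts G" using G by (simp add: rooted_graph_def)
  then show "fps_nth (Abs_fps (root_moment G)) n = fps_nth (u (rt G)) n"
    using coeff_walk_system[OF rooted_graph_locally_finite[OF G] _ assms(2), of "rt G" n]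
    by (simp add: root_moment_def vec_state_eq adjacency_def)
qed

section \<open>The orthogonal product\<close>

lemma sum_singleton_Times: "(\<Sum>z\<in>{c} \<times> A. F z) = (\<Sum>y\<in>A. F (c, y))"
  by (rule sum.reindex_bij_witness[of _ "Pair c" snd]) auto

lemma sum_Times_singleton: "(\<Sum>z\<in>A \<times> {c}. F z) = (\<Sum>x\<in>A. F (x, c))"
  by (rule sum.reindex_bij_witness[of _ "\<lambda>x. (x, c)" fst]) auto

lemma nbrs_orth_edges1:
  "nbrs (orth_edges1 G H) (x, y) = (if y = rt H then nbrs (edges G) x \<times> {rt H} else {})"
  by (auto simp: nbrs_def orth_edges1_def doubleton_eq_iff insert_commute)

lemma nbrs_orth_edges2:
  "nbrs (orth_edges2 G H) (x, y) =
    (if x \<in> verts G - {rt G} then {x} \<times> nbrs (edges H) y else {})"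
  by (auto simp: nbrs_def orth_edges2_def doubleton_eq_iff insert_commute)

lemma edges_orth_prod: "edges (orth_prod G H) = orth_edges1 G H \<union> orth_edges2 G H"
  by (simp add: orth_prod_def)

lemma rt_orth_prod: "rt (orth_prod G H) = (rt G, rt H)"
  by (simp add: orth_prod_def)

lemma verts_orth_prod:
  "(x, y) \<in> verts (orth_prod G H) \<longleftrightarrow>
    x \<in> verts G \<and> x \<noteq> rt G \<and> y \<in> verts H \<or> x = rt G \<and> y = rt H"
  by (auto simp: orth_prod_def)

lemma locally_finite_orth_edges1:
  assumes "rooted_graph G" "rooted_graph H"
  shows "locally_finite (verts (orth_prod G H)) (orth_edges1 G H)"
proof -
  have "rt G \<in> verts G" "rt H \<in> verts H" using assms by (auto simp: rooted_graph_def)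
  then show ?thesis
    using locally_finiteD[OF rooted_graph_locally_finite[OF assms(1)]]
    by (auto simp: locally_finite_def[of "verts (orth_prod G H)"] nbrs_orth_edges1 verts_orth_prod
        split: if_splits)
qed

lemma locally_finite_orth_edges2:
  assumes "rooted_graph G" "rooted_graph H"
  shows "locally_finite (verts (orth_prod G H)) (orth_edges2 G H)"
  using locally_finiteD[OF rooted_graph_locally_finite[OF assms(2)]]
  by (auto simp: locally_finite_def[of "verts (orth_prod G H)"] nbrs_orth_edges2 verts_orth_prod)

text \<open>Edges of the second kind keep the first coordinate, while edges of the first kind change
  it because \<open>G\<close> has no loops; hence the neighbourhoods are disjoint.\<close>

lemma adjacency_orth_prod:
  assumes "rooted_graph G" "rooted_graph H"
  defines "V \<equiv> verts (orth_prod G H)"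
  shows "adjacency (orth_prod G H) =
    adj_op V (orth_edges1 G H) \<oplus>\<^bsub>op_alg V\<^esub> adj_op V (orth_edges2 G H)"
  unfolding adjacency_def edges_orth_prod V_def
  using rooted_graph_irrefl[OF assms(1)] assms
  by (intro adj_op_union locally_finite_orth_edges1 locally_finite_orth_edges2)
     (auto simp: nbrs_orth_edges1 nbrs_orth_edges2 split: if_splits)

section \<open>Orthogonality of the two summands\<close>

text \<open>A product inherits the property from its left factor. It matters that the algebra is
  non-unital: the identity does not have this range.\<close>

lemma gen_alg1_range:
  assumes G: "rooted_graph G" "rooted_graph H"
  defines "V \<equiv> verts (orth_prod G H)"
  assumes a: "a \<in> gen_alg (op_alg V) {adj_op V (orth_edges1 G H)}"
    and f: "f \<in> fin_supp V" and y: "y \<noteq> rt H"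
  shows "Poly_Mapping.lookup (a f) (x, y) = 0"
proof -
  have lf: "locally_finite V (orth_edges1 G H)"
    unfolding V_def by (rule locally_finite_orth_edges1[OF G])
  have C: "gen_alg (op_alg V) {adj_op V (orth_edges1 G H)} \<subseteq> carrier (op_alg V)"
    using adj_op_carrier[OF lf] by (intro gen_alg_subset_carrier) auto
  show ?thesis
    using a f
  proof (induction arbitrary: f)
    case (incl a)
    then show ?case
      using y lf lookup_adj_op[OF lf incl.prems, of "(x, y)"]
        lookup_adj_op_outside[OF lf incl.prems, of "(x, y)"]
      by (cases "(x, y) \<in> V") (auto simp: nbrs_orth_edges1)
  next
    case (mult a b)
    have "b f \<in> fin_supp V"
      using mult.prems by (rule op_alg_carrierD(1)[OF subsetD[OF C mult.hyps(2)]])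
    then show ?case using mult by (simp add: op_alg_apply)
  qed (auto simp: op_alg_apply lookup_add)
qed

text \<open>The counterpart of \<open>gen_alg1_range\<close> for arguments: here a product inherits
  the property from its right factor.\<close>

lemma gen_alg1_kernel:
  assumes G: "rooted_graph G" "rooted_graph H"
  defines "V \<equiv> verts (orth_prod G H)"
  assumes a: "a \<in> gen_alg (op_alg V) {adj_op V (orth_edges1 G H)}"
    and f: "f \<in> fin_supp V" and z: "\<And>x. Poly_Mapping.lookup f (x, rt H) = 0"
  shows "a f = 0"
proof -
  have lf: "locally_finite V (orth_edges1 G H)"
    unfolding V_def by (rule locally_finite_orth_edges1[OF G])
  have C: "gen_alg (op_alg V) {adj_op V (orth_edges1 G H)} \<subseteq> carrier (op_alg V)"
    using adj_op_carrier[OF lf] by (intro gen_alg_subset_carrier) auto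
  show ?thesis
    using a
  proof induction
    case (incl a)
    show ?case
    proof (rule poly_mapping_eqI)
      fix p
      show "Poly_Mapping.lookup (a f) p = Poly_Mapping.lookup 0 p"
      proof (cases "p \<in> V")
        case True
        then show ?thesis
          using incl z lookup_adj_op[OF lf f True]
          by (cases p) (auto simp: nbrs_orth_edges1 intro!: sum.neutral)
      next
        case False
        then show ?thesis
          using incl lookup_adj_op_outside[OF lf f False] by auto
      qed
    qed
  next
    case (mult a b)
    then have "a \<in> carrier (op_alg V)" using C by blast
    then show ?case using mult f by (simp add: op_alg_apply op_alg_zero_app)
  qed (use f in \<open>auto simp: op_alg_apply\<close>)
qed

text \<open>The root has no neighbour along edges of the second kind. The two claims yield the two
  halves of condition (i) of orthogonality, with \<open>b\<close> on the left and on the right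
  respectively.\<close>

lemma gen_alg2_root:
  assumes G: "rooted_graph G" "rooted_graph H"
  defines "V \<equiv> verts (orth_prod G H)"
  assumes b: "b \<in> gen_alg (op_alg V) {adj_op V (orth_edges2 G H)}"
  shows "f \<in> fin_supp V \<Longrightarrow> Poly_Mapping.lookup (b f) (rt G, rt H) = 0"
    and "b (delta (rt G, rt H)) = 0"
proof -
  have lf: "locally_finite V (orth_edges2 G H)"
    unfolding V_def by (rule locally_finite_orth_edges2[OF G])
  have C: "gen_alg (op_alg V) {adj_op V (orth_edges2 G H)} \<subseteq> carrier (op_alg V)"
    using adj_op_carrier[OF lf] by (intro gen_alg_subset_carrier) auto
  have e: "(rt G, rt H) \<in> V" by (simp add: V_def verts_orth_prod)
  show "Poly_Mapping.lookup (b f) (rt G, rt H) = 0" if "f \<in> fin_supp V" for f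
    using b that
  proof (induction arbitrary: f)
    case (incl a)
    then show ?case
      using lookup_adj_op[OF lf incl.prems e] by (auto simp: nbrs_orth_edges2)
  next
    case (mult a b)
    have "b f \<in> fin_supp V"
      using mult.prems by (rule op_alg_carrierD(1)[OF subsetD[OF C mult.hyps(2)]])
    then show ?case using mult by (simp add: op_alg_apply)
  qed (auto simp: op_alg_apply lookup_add)
  show "b (delta (rt G, rt H)) = 0"
    using b
  proof induction
    case (incl a)
    have "nbrs (orth_edges2 G H) (rt G, rt H) = {}" by (simp add: nbrs_orth_edges2)
    then show ?case
      using incl delta_in_fin_supp[of "(rt G, rt H)" V] e by (simp add: adj_op_def delta_def)
  next
    case (mult a b)
    then have "a \<in> carrier (op_alg V)" using C by blast
    then show ?case using mult e by (simp add: op_alg_apply op_alg_zero_app)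
  qed (use e in \<open>auto simp: op_alg_apply\<close>)
qed

text \<open>Every fibre over a vertex other than \<open>rt G\<close> is a copy of \<open>H\<close>,
  preserved by the generator, which acts there as the adjacency operator of \<open>H\<close>. For
  products, the agreement of \<open>b f\<close> and \<open>b g\<close> on the whole fibres is fed
  into the hypothesis for \<open>a\<close>, so \<open>f\<close>, \<open>g\<close> and
  \<open>y\<close> stay arbitrary in the induction.\<close>

lemma gen_alg2_fibre:
  assumes G: "rooted_graph G" "rooted_graph H"
  defines "V \<equiv> verts (orth_prod G H)"
  assumes b: "b \<in> gen_alg (op_alg V) {adj_op V (orth_edges2 G H)}"
    and "f \<in> fin_supp V" "g \<in> fin_supp V"
    and x: "x \<in> verts G - {rt G}" "x' \<in> verts G - {rt G}"
    and "\<And>y. Poly_Mapping.lookup f (x, y) = Poly_Mapping.lookup g (x', y)"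
  shows "Poly_Mapping.lookup (b f) (x, y) = Poly_Mapping.lookup (b g) (x', y)"
proof -
  have lf: "locally_finite V (orth_edges2 G H)"
    unfolding V_def by (rule locally_finite_orth_edges2[OF G])
  have C: "gen_alg (op_alg V) {adj_op V (orth_edges2 G H)} \<subseteq> carrier (op_alg V)"
    using adj_op_carrier[OF lf] by (intro gen_alg_subset_carrier) auto
  show ?thesis
    using b assms(5,6,9)
  proof (induction arbitrary: f g y)
    case (incl a)
    show ?case
    proof (cases "y \<in> verts H")
      case True
      then have "(x, y) \<in> V" "(x', y) \<in> V"
        using x by (auto simp: V_def verts_orth_prod)
      then show ?thesis
        using incl x by (auto simp: lookup_adj_op[OF lf] nbrs_orth_edges2 sum_singleton_Times)
    next
      case False
      then have "(x, y) \<notin> V" "(x', y) \<notin> V"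
        using x by (auto simp: V_def verts_orth_prod)
      then show ?thesis
        using incl by (auto simp: lookup_adj_op_outside[OF lf])
    qed
  next
    case (mult a b)
    have "b f \<in> fin_supp V" "b g \<in> fin_supp V"
      using mult.prems(1,2) by (auto intro!: op_alg_carrierD(1)[OF subsetD[OF C mult.hyps(2)]])
    then show ?case using mult by (simp add: op_alg_apply)
  next
    case (add a b)
    have "Poly_Mapping.lookup (a f) (x, y) = Poly_Mapping.lookup (a g) (x', y)"
      "Poly_Mapping.lookup (b f) (x, y) = Poly_Mapping.lookup (b g) (x', y)"
      using add.prems by (auto intro!: add.IH)
    then show ?case using add.prems by (simp add: op_alg_apply lookup_add)
  next
    case (smult a c)
    have "Poly_Mapping.lookup (a f) (x, y) = Poly_Mapping.lookup (a g) (x', y)"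
      using smult.prems by (auto intro!: smult.IH)
    then show ?case using smult.prems by (simp add: op_alg_apply)
  qed (simp add: op_alg_apply)
qed

text \<open>On each fibre such an \<open>f\<close> is a multiple of the delta at the root of the
  copy of \<open>H\<close>, so \<open>b\<close> contributes the same scalar on all fibres away from
  \<open>rt G\<close>. This is why \<psi> may be taken at any \<open>v\<close>.\<close>

lemma gen_alg2_compression:
  assumes G: "rooted_graph G" "rooted_graph H"
  defines "V \<equiv> verts (orth_prod G H)"
  assumes b: "b \<in> gen_alg (op_alg V) {adj_op V (orth_edges2 G H)}"
    and f: "f \<in> fin_supp V" and supp: "\<And>x y. y \<noteq> rt H \<Longrightarrow> Poly_Mapping.lookup f (x, y) = 0"
    and v: "v \<in> verts G - {rt G}"
  shows "Poly_Mapping.lookup (b f) (x, rt H) =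
    vec_state (v, rt H) b *
      (if x = rt G then 0 else Poly_Mapping.lookup f (x, rt H))"
proof -
  have lf: "locally_finite V (orth_edges2 G H)"
    unfolding V_def by (rule locally_finite_orth_edges2[OF G])
  have "gen_alg (op_alg V) {adj_op V (orth_edges2 G H)} \<subseteq> carrier (op_alg V)"
    using adj_op_carrier[OF lf] by (intro gen_alg_subset_carrier) auto
  then have bC: "b \<in> carrier (op_alg V)" using b by auto
  show ?thesis
  proof (cases "x \<in> verts G - {rt G}")
    case True
    have "rt H \<in> verts H" using G by (simp add: rooted_graph_def)
    then have vV: "(v, rt H) \<in> V" using v by (auto simp: V_def verts_orth_prod)
    \<comment> \<open>The restriction of \<open>f\<close> to the fibre over \<open>x\<close>,
      transported to the fibre over \<open>v\<close>.\<close>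
    define g where "g = scale_fn (Poly_Mapping.lookup f (x, rt H)) (delta (v, rt H))"
    have "Poly_Mapping.lookup (b f) (x, rt H) = Poly_Mapping.lookup (b g) (v, rt H)"
      unfolding g_def
    proof (rule gen_alg2_fibre[OF G b[unfolded V_def] f[unfolded V_def] _ True v])
      show "scale_fn (Poly_Mapping.lookup f (x, rt H)) (delta (v, rt H))
          \<in> fin_supp (verts (orth_prod G H))"
        using vV by (simp add: V_def)
    qed (use supp in \<open>auto simp: lookup_delta\<close>)
    also have "\<dots> = Poly_Mapping.lookup f (x, rt H) * vec_state (v, rt H) b"
      using vV by (simp add: g_def op_alg_carrierD(3)[OF bC] vec_state_eq)
    finally show ?thesis using True by simp
  next
    \<comment> \<open>Either \<open>x\<close> is \<open>rt G\<close>, where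
      \<open>gen_alg2_root\<close> applies, or \<open>(x, rt H)\<close> lies outside
      \<open>V\<close> and both sides vanish.\<close>
    case False
    have "b f \<in> fin_supp V" by (rule op_alg_carrierD(1)[OF bC f])
    moreover have "(x, rt H) \<notin> V" if "x \<noteq> rt G"
      using that False by (auto simp: V_def verts_orth_prod)
    ultimately show ?thesis
      using f gen_alg2_root(1)[OF G, of b f] b by (auto simp: fin_supp_iff V_def)
  qed
qed

text \<open>Between \<open>a1\<close> and \<open>a2\<close>, \<open>b\<close> acts as \<psi>(b)
  times the identity minus the projection onto the delta at the root. The projection has rank one,
  so its term splits into the product of two values of \<phi> in condition (ii).\<close>

lemma orthogonal_pair_orth_prod:
  assumes G: "rooted_graph G" "rooted_graph H" and v: "v \<in> verts G - {rt G}"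
  defines "V \<equiv> verts (orth_prod G H)"
  shows "orthogonal_pair (op_alg V) (vec_state (rt G, rt H)) (vec_state (v, rt H))
    (adj_op V (orth_edges1 G H)) (adj_op V (orth_edges2 G H))"
  unfolding orthogonal_pair_def orthogonal_subalg_def
proof (intro ballI)
  let ?A = "gen_alg (op_alg V) {adj_op V (orth_edges1 G H)}"
  let ?B = "gen_alg (op_alg V) {adj_op V (orth_edges2 G H)}"
  let ?e = "(rt G, rt H)"
  fix a1 a2 b w1 w2
  assume a1: "a1 \<in> ?A" and a2: "a2 \<in> ?A" and b: "b \<in> ?B"
    and w1: "w1 \<in> gen_unital_alg (op_alg V) (?A \<union> ?B)"
    and w2: "w2 \<in> gen_unital_alg (op_alg V) (?A \<union> ?B)"
  have CA: "?A \<subseteq> carrier (op_alg V)"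
    unfolding V_def using adj_op_carrier[OF locally_finite_orth_edges1[OF G]]
    by (intro gen_alg_subset_carrier) auto
  have CB: "?B \<subseteq> carrier (op_alg V)"
    unfolding V_def using adj_op_carrier[OF locally_finite_orth_edges2[OF G]]
    by (intro gen_alg_subset_carrier) auto
  have CW: "gen_unital_alg (op_alg V) (?A \<union> ?B) \<subseteq> carrier (op_alg V)"
    using CA CB by (intro gen_unital_alg_subset_carrier) auto
  have c: "a1 \<in> carrier (op_alg V)" "a2 \<in> carrier (op_alg V)" "b \<in> carrier (op_alg V)"
    "w1 \<in> carrier (op_alg V)" "w2 \<in> carrier (op_alg V)"
    using CA CB CW a1 a2 b w1 w2 by auto
  note cl = c[THEN op_alg_carrierD(1)]
  note lin = op_alg_carrierD(2,3)
  have e: "delta ?e \<in> fin_supp V" by (simp add: V_def verts_orth_prod)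
  define h where "h = a2 (w2 (delta ?e))"
  have h: "h \<in> fin_supp V" using e cl by (simp add: h_def)
  have supp: "Poly_Mapping.lookup h (x, y) = 0" if "y \<noteq> rt H" for x y
    unfolding h_def using gen_alg1_range[OF G, of a2] a2 that cl(5)[OF e] by (auto simp: V_def)
  define s where "s = vec_state (v, rt H) b"
  define t where "t = Poly_Mapping.lookup h ?e"
  \<comment> \<open>\<psi>(b) times \<open>h\<close> with its value at the root removed. By the
    compression lemma \<open>b h\<close> and \<open>k\<close> agree at all points
    \<open>(x, rt H)\<close>, and \<open>a1\<close> sees nothing else.\<close>
  define k where "k = scale_fn s (h + scale_fn (- t) (delta ?e))"
  have k: "k \<in> fin_supp V" using h e by (simp add: k_def)
  have "a1 (b h) = a1 k"
  proof (rule op_alg_agree[OF c(1) cl(3)[OF h] k])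
    show "a1 (b h - k) = 0"
      unfolding V_def
    proof (rule gen_alg1_kernel[OF G a1[unfolded V_def]])
      show "b h - k \<in> fin_supp (verts (orth_prod G H))"
        using k cl(3)[OF h] unfolding V_def by simp
      fix x
      show "Poly_Mapping.lookup (b h - k) (x, rt H) = 0"
        using gen_alg2_compression[OF G _ _ supp v, of b x] b h
        by (auto simp: V_def k_def s_def t_def lookup_add lookup_minus lookup_delta)
    qed
  qed
  also have "\<dots> = scale_fn s (a1 h + scale_fn (- t) (a1 (delta ?e)))"
    using h e by (simp add: k_def lin[OF c(1)])
  finally have "w1 (a1 (b h)) =
      scale_fn s (w1 (a1 h) + scale_fn (- t) (w1 (a1 (delta ?e))))"
    using h e cl by (simp add: lin[OF c(4)])
  \<comment> \<open>Here \<open>t\<close> is \<phi>(a2 w2), by the choice of \<open>h\<close>, so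
    the subtracted term is already the required product.\<close>
  then have 1: "Poly_Mapping.lookup (w1 (a1 (b h))) ?e =
      s * (Poly_Mapping.lookup (w1 (a1 h)) ?e - Poly_Mapping.lookup (w1 (a1 (delta ?e))) ?e * t)"
    by (simp add: lookup_add algebra_simps)
  have 2: "Poly_Mapping.lookup (b (w2 (delta ?e))) ?e = 0"
    using gen_alg2_root(1)[OF G, of b "w2 (delta ?e)"] b cl(5)[OF e] by (simp add: V_def)
  have 3: "b (delta ?e) = 0"
    using gen_alg2_root(2)[OF G, of b] b by (simp add: V_def)
  show "vec_state ?e (b \<otimes>\<^bsub>op_alg V\<^esub> w2) = 0 \<and> vec_state ?e (w1 \<otimes>\<^bsub>op_alg V\<^esub> b) = 0 \<and>
    vec_state ?e (w1 \<otimes>\<^bsub>op_alg V\<^esub> a1 \<otimes>\<^bsub>op_alg V\<^esub> b \<otimes>\<^bsub>op_alg V\<^esub> a2 \<otimes>\<^bsub>op_alg V\<^esub> w2) =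
      vec_state (v, rt H) b *
        (vec_state ?e (w1 \<otimes>\<^bsub>op_alg V\<^esub> a1 \<otimes>\<^bsub>op_alg V\<^esub> a2 \<otimes>\<^bsub>op_alg V\<^esub> w2)
          - vec_state ?e (w1 \<otimes>\<^bsub>op_alg V\<^esub> a1) * vec_state ?e (a2 \<otimes>\<^bsub>op_alg V\<^esub> w2))"
    unfolding vec_state_eq[of ?e] s_def[symmetric]
    using e cl 1 2 by (simp add: op_alg_apply 3 op_alg_zero_app[OF c(4)] h_def t_def)
qed

section \<open>The moments of the orthogonal product\<close>

lemma root_moment_0:
  assumes "rooted_graph G"
  shows "root_moment G 0 = 1"
proof -
  have "rt G \<in> verts G" using assms by (simp add: rooted_graph_def)
  then show ?thesis by (simp add: root_moment_def vec_state_one)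
qed

text \<open>This is the identity of the \<open>K\<close>-transforms with denominators cleared, so
  that it lives in power series.\<close>

lemma moments_orth_prod:
  fixes G :: "'a rgraph" and H :: "'b rgraph"
  assumes G: "rooted_graph G" "rooted_graph H"
  defines "N \<equiv> Abs_fps (root_moment H)"
  defines "M \<equiv> Abs_fps (root_moment G) oo (fps_X * N)"
  shows "Abs_fps (root_moment (orth_prod G H)) * (M * N - M + 1) = M * N"
proof -
  have rV: "rt G \<in> verts G" "rt H \<in> verts H" using G by (auto simp: rooted_graph_def)
  obtain g :: "'a \<Rightarrow> complex fps" where g: "\<And>x. x \<in> verts G \<Longrightarrow>
      g x = (if x = rt G then 1 else 0) + fps_X * (\<Sum>z\<in>nbrs (edges G) x. g z)"
    using walk_system_exists[OF rooted_graph_locally_finite[OF G(1)] rV(1)] by blast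
  obtain h :: "'b \<Rightarrow> complex fps" where h: "\<And>x. x \<in> verts H \<Longrightarrow>
      h x = (if x = rt H then 1 else 0) + fps_X * (\<Sum>z\<in>nbrs (edges H) x. h z)"
    using walk_system_exists[OF rooted_graph_locally_finite[OF G(2)] rV(2)] by blast
  have N: "N = h (rt H)"
    unfolding N_def by (rule root_moment_walk_system[OF G(2) h])
  have N0: "fps_nth N 0 = 1" by (simp add: N_def root_moment_0 G)
  define g' where "g' x = g x oo (fps_X * N)" for x
  have M: "M = g' (rt G)"
    unfolding M_def g'_def using root_moment_walk_system[OF G(1) g] by simp
  \<comment> \<open>Substituting \<open>fps_X * N\<close> for the variable gives each step in
    \<open>G\<close> the weight \<open>fps_X * N\<close>: the step itself, together with the closed
    walks at the root of a copy of \<open>H\<close>.\<close>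
  have g': "g' x = (if x = rt G then 1 else 0) + fps_X * N * (\<Sum>z\<in>nbrs (edges G) x. g' z)"
    if "x \<in> verts G" for x
    unfolding g'_def
    by (subst g[OF that])
       (simp add: fps_compose_add_distrib fps_compose_mult_distrib fps_compose_sum_distrib)
  have M0: "fps_nth M 0 = 1" using g'[OF rV(1)] by (simp add: M)
  define D where "D = M * N - M + 1"
  have D0: "fps_nth D 0 = 1" by (simp add: D_def M0 N0)
  \<comment> \<open>Forced by the equation at the root: there the ansatz requires
    \<open>c * M * N = 1 + c * (M - 1)\<close>, that is \<open>c * D = 1\<close>. The root carries
    no copy of \<open>H\<close>, and \<open>c\<close> corrects for that.\<close>
  define c where "c = inverse D"
  have cD: "c * D = 1"
    unfolding c_def by (rule inverse_mult_eq_1) (simp add: D0)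
  define i where "i = inverse N"
  have iN: "i * N = 1"
    unfolding i_def by (rule inverse_mult_eq_1) (simp add: N0)
  define u where "u p = c * g' (fst p) * h (snd p)" for p
  define S where "S = fps_X * (\<Sum>z\<in>nbrs (edges G) (rt G). g' z)"
  have "u p = (if p = rt (orth_prod G H) then 1 else 0) +
      fps_X * (\<Sum>z\<in>nbrs (edges (orth_prod G H)) p. u z)" if "p \<in> verts (orth_prod G H)" for p
  proof (cases p)
    case (Pair x y)
    have nb: "nbrs (edges (orth_prod G H)) (x, y) =
        nbrs (orth_edges1 G H) (x, y) \<union> nbrs (orth_edges2 G H) (x, y)"
      by (auto simp: edges_orth_prod nbrs_def)
    have "finite (nbrs (orth_edges1 G H) (x, y))" "finite (nbrs (orth_edges2 G H) (x, y))"
      "nbrs (orth_edges1 G H) (x, y) \<inter> nbrs (orth_edges2 G H) (x, y) = {}"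
      using that Pair locally_finite_orth_edges1[OF G] locally_finite_orth_edges2[OF G]
        rooted_graph_irrefl[OF G(1)]
      by (auto simp: locally_finite_def nbrs_orth_edges1 nbrs_orth_edges2)
    then have split: "(\<Sum>z\<in>nbrs (edges (orth_prod G H)) (x, y). u z) =
        (\<Sum>z\<in>nbrs (orth_edges1 G H) (x, y). u z) + (\<Sum>z\<in>nbrs (orth_edges2 G H) (x, y). u z)"
      unfolding nb by (rule sum.union_disjoint)
    have s1: "(\<Sum>z\<in>nbrs (orth_edges1 G H) (x, y). u z) =
        (if y = rt H then c * N * (\<Sum>z\<in>nbrs (edges G) x. g' z) else 0)"
      by (simp add: nbrs_orth_edges1 u_def N sum_distrib_left sum_Times_singleton mult_ac)
    have s2: "(\<Sum>z\<in>nbrs (orth_edges2 G H) (x, y). u z) =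
        (if x \<in> verts G - {rt G} then c * g' x * (\<Sum>z\<in>nbrs (edges H) y. h z) else 0)"
      by (simp add: nbrs_orth_edges2 u_def sum_distrib_left sum_singleton_Times)
    show ?thesis
    proof (cases "x = rt G")
      case True
      then have y: "y = rt H" using that Pair by (simp add: verts_orth_prod)
      have "N * S = M - 1"
        unfolding S_def using g'[OF rV(1)] by (simp add: M mult_ac)
      have "u p = c * M * N" using Pair True y by (simp add: u_def M N)
      also have "\<dots> = c * D + c * (M - 1)" by (simp add: D_def algebra_simps)
      also have "\<dots> = 1 + c * (N * S)"
        by (simp add: cD \<open>N * S = M - 1\<close>)
      finally show ?thesis
        using Pair True y split s1 s2 by (simp add: rt_orth_prod S_def mult_ac)
    next
      case False
      then have x: "x \<in> verts G" and y: "y \<in> verts H"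
        using that Pair by (auto simp: verts_orth_prod)
      have gx: "g' x = fps_X * N * (\<Sum>z\<in>nbrs (edges G) x. g' z)"
        using g'[OF x] False by simp
      \<comment> \<open>Away from the root, the equation for \<open>h\<close> accounts for the edges
        of the second kind. Its source term at \<open>y = rt H\<close>, rewritten by
        \<open>gx\<close>, becomes the sum over the edges of the first kind, with \<open>N\<close>
        as the value of \<open>h\<close> at \<open>rt H\<close>.\<close>
      have "u p = c * g' x * (if y = rt H then 1 else 0) +
          fps_X * (c * g' x * (\<Sum>z\<in>nbrs (edges H) y. h z))"
        using Pair h[OF y] by (simp add: u_def algebra_simps)
      also have "c * g' x * (if y = rt H then 1 else 0) =
          fps_X * (if y = rt H then c * N * (\<Sum>z\<in>nbrs (edges G) x. g' z) else 0)"
        by (subst gx) (simp add: mult_ac)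
      finally show ?thesis
        using Pair False x split s1 s2 by (simp add: rt_orth_prod algebra_simps)
    qed
  qed
  then have "Abs_fps (root_moment (orth_prod G H)) = u (rt (orth_prod G H))"
    by (rule root_moment_walk_system[OF rooted_graph_orth_prod[OF G]])
  then have "Abs_fps (root_moment (orth_prod G H)) * D = (c * D) * (M * N)"
    by (simp add: u_def rt_orth_prod M N mult_ac)
  then show ?thesis by (simp add: cD flip: D_def)
qed

text \<open>With \<open>X\<close> for 1/z, the \<open>K\<close>-transform of \<open>m\<close> is 1/X
  - 1/(XL), and the substituted one of \<open>m1\<close> is 1/(XN) - 1/(XNM). Dividing
  \<open>eq\<close> by \<open>L * M * N\<close> expresses 1/L through \<open>M\<close> and
  \<open>N\<close> and equates the two.\<close>

lemma orth_conv_momentsI: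
  fixes m m1 m2 :: "nat \<Rightarrow> complex"
  assumes 1: "m 0 = 1" "m1 0 = 1" "m2 0 = 1"
  defines "N \<equiv> Abs_fps m2"
  defines "M \<equiv> Abs_fps m1 oo (fps_X * N)"
  assumes eq: "Abs_fps m * (M * N - M + 1) = M * N"
  shows "orth_conv_moments m m1 m2"
proof -
  define h where "h = fps_X * N"
  define L where "L = fps_to_fls (Abs_fps m)"
  define M' where "M' = fps_to_fls M"
  define N' where "N' = fps_to_fls N"
  define X :: "complex fls" where "X = fls_X"
  have "N \<noteq> 0" "Abs_fps m \<noteq> 0" "Abs_fps m1 \<noteq> 0"
    using 1 by (auto simp: N_def fps_eq_iff intro!: exI[of _ 0])
  then have h [simp]: "h \<noteq> 0" "fps_nth h 0 = 0" by (auto simp: h_def)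
  have "fps_nth M 0 = 1" using 1 by (simp add: M_def)
  then have "M \<noteq> 0" by auto
  have nz: "L \<noteq> 0" "M' \<noteq> 0" "N' \<noteq> 0" "X \<noteq> 0"
    using \<open>N \<noteq> 0\<close> \<open>M \<noteq> 0\<close> \<open>Abs_fps m \<noteq> 0\<close> by (auto simp: L_def M'_def N'_def X_def)
  have X_inv: "fls_X_inv = inverse X" by (simp add: X_def fls_inverse_X)
  have G: "G_transform a = X * fps_to_fls (Abs_fps a)" for a
    by (simp add: G_transform_def fls_times_fps_to_fls X_def)
  \<comment> \<open>The inverse of the \<open>F\<close>-transform is the \<open>G\<close>-transform,
    a power series, so passing to the regular part loses nothing.\<close>
  have "fls_regpart (inverse (F_transform m2)) = h"
    by (simp add: F_transform_def G_transform_def h_def N_def)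
  then have "subst_z (K_transform m1) (F_transform m2) =
      fls_compose_fps (inverse X - inverse (X * fps_to_fls (Abs_fps m1))) h"
    by (simp add: subst_z_def K_transform_def F_transform_def G X_inv)
  also have "\<dots> = inverse (X * N') - inverse (X * N' * M')"
    by (simp add: fls_compose_fps_diff fls_compose_fps_inverse fls_compose_fps_mult X_def
        N'_def M'_def M_def fls_times_fps_to_fls flip: h_def)
       (simp add: h_def fls_times_fps_to_fls)
  finally have R: "subst_z (K_transform m1) (F_transform m2) =
      inverse (X * N') - inverse (X * N' * M')" .
  have K: "K_transform m = inverse X - inverse (X * L)"
    by (simp add: K_transform_def F_transform_def G X_inv L_def)
  have "L * (M' * N' - M' + 1) = M' * N'"
    using arg_cong[OF eq, of fps_to_fls]
    by (simp add: L_def M'_def N'_def fls_times_fps_to_fls)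
  then have "inverse L = (M' * N' - M' + 1) / (M' * N')"
    using nz by (simp add: field_simps)
  then have "K_transform m = inverse X * (1 - (M' * N' - M' + 1) / (M' * N'))"
    using K by (simp add: algebra_simps)
  also have "\<dots> = inverse (X * N') - inverse (X * N' * M')"
    using nz by (simp add: field_simps)
  finally show ?thesis
    unfolding orth_conv_moments_def R .
qed

lemma orth_conv_moments_orth_prod:
  assumes "rooted_graph G" "rooted_graph H"
  shows "orth_conv_moments (root_moment (orth_prod G H)) (root_moment G) (root_moment H)"
  using assms
  by (intro orth_conv_momentsI moments_orth_prod root_moment_0 rooted_graph_orth_prod)

lemma moment_spectral_distribution:
  assumes "spectral_distribution G \<mu>"
  shows "moment \<mu> = root_moment G"
  using assms by (auto simp: spectral_distribution_def moment_def)

text \<open>The summands come from splitting the edge set. Spectral distributions enter the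
  convolution identity only through their moments, which are the root moments, so it reduces to
  \<open>orth_conv_moments_orth_prod\<close>.\<close>

theorem theorem4p1:
  fixes G1 :: "'a rgraph" and G2 :: "'b rgraph"
    and \<mu> \<nu> :: "real measure" and v :: 'a
  assumes "rooted_graph G1" and "rooted_graph G2"
    and "spectral_distribution G1 \<mu>" and "spectral_distribution G2 \<nu>"
    and "v \<in> verts G1 - {rt G1}"
  shows "(\<exists>A1 A2.
            A1 \<in> carrier (op_alg (verts (orth_prod G1 G2))) \<and>
            A2 \<in> carrier (op_alg (verts (orth_prod G1 G2))) \<and>
            A1 = adj_op (verts (orth_prod G1 G2)) (orth_edges1 G1 G2) \<and>
            A2 = adj_op (verts (orth_prod G1 G2)) (orth_edges2 G1 G2) \<and>
            adjacency (orth_prod G1 G2) = A1 \<oplus>\<^bsub>op_alg (verts (orth_prod G1 G2))\<^esub> A2 \<and>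
            orthogonal_pair (op_alg (verts (orth_prod G1 G2)))
              (vec_state (rt (orth_prod G1 G2))) (vec_state (v, rt G2)) A1 A2)
       \<and> orth_conv_moments (root_moment (orth_prod G1 G2)) (moment \<mu>) (moment \<nu>)
       \<and> (\<forall>\<rho>. spectral_distribution (orth_prod G1 G2) \<rho> \<longrightarrow>
            orth_conv_moments (moment \<rho>) (moment \<mu>) (moment \<nu>))"
  using adj_op_carrier[OF locally_finite_orth_edges1[OF assms(1,2)]]
    adj_op_carrier[OF locally_finite_orth_edges2[OF assms(1,2)]]
    adjacency_orth_prod[OF assms(1,2)]
    orthogonal_pair_orth_prod[OF assms(1,2,5)]
    orth_conv_moments_orth_prod[OF assms(1,2)]
    assms(3,4)[THEN moment_spectral_distribution]
  by (simp add: rt_orth_prod moment_spectral_distribution)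

end
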